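(* Let $n\ge 2$, let $c>0$, and let $f(x)=e^{cx}-1$ be the weight function of a winners-pay quasi-proportional auction with $n$ bidders having private values $v_1,\dots,v_n>0$. Suppose $\mathbf{w}=(w_1,\dots,w_n)\in[0,\infty)^n$ has at least two positive entries and satisfies, for every $i\in\{1,\dots,n\}$, $$ w_i \le v_i - \frac{1}{c}\left(1-\frac{1}{e^{c w_i}}\right)\left(\frac{1}{1-a_i(\mathbf{w})}\right), $$ where $a_i(\mathbf{w})$ is the allocation to bidder $i$ when the bid vector is $\mathbf{w}$. Then there exists $\mathbf{b}^*\in[w_1,v_1]\times\cdots\times[w_n,v_n]$ such that $\mathbf{BR}(\mathbf{b}^* )=\mathbf{b}^*$.
   Context: Winners-pay quasi-proportional auction: each bidder $i$ submits a bid $b_i\ge 0$. Given the bid vector $\mathbf{b}=(b_1,\dots,b_n)$ and a weight function $f$, bidder $i$ receives the allocation $a_i(\mathbf{b})=\frac{f(b_i)}{\sum_{j=1}^n f(b_j)}$ (defined when the denominator is nonzero) and has utility $u_i(\mathbf{b})=(v_i-b_i)\,a_i(\mathbf{b})$, where $v_i$ is bidder $i$'s private value for a full allocation. For a bid vector $\mathbf{b}$ with at least two positive bids, $\mathrm{BR}_i(\mathbf{b})$, bidder $i$'s best response, is the bid in $[0,\infty)$ that maximizes bidder $i$'s utility when the other bidders' bids are held fixed at $b_j$, $j\ne i$ (for this $f$ the maximizer exists and is unique). $\mathbf{BR}(\mathbf{b})=(\mathrm{BR}_1(\mathbf{b}),\dots,\mathrm{BR}_n(\mathbf{b}))$; a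 fixed point of $\mathbf{BR}$ is a pure-strategy Nash equilibrium. *)

theory Defs
  imports "HOL-Analysis.Analysis"
begin

text \<open>Bid vectors and value vectors are elements of \<open>real ^ 'n\<close>, the index type being the
  set of bidders. The functions below are parametrised by the weight function \<open>f\<close>.\<close>

text \<open>Only meaningful when the denominator is nonzero.\<close>

definition allocation :: "(real \<Rightarrow> real) \<Rightarrow> real ^ 'n \<Rightarrow> 'n::finite \<Rightarrow> real" where
  "allocation f b i = f (b $ i) / (\<Sum>j\<in>UNIV. f (b $ j))"

definition utility :: "(real \<Rightarrow> real) \<Rightarrow> real ^ 'n \<Rightarrow> real ^ 'n \<Rightarrow> 'n::finite \<Rightarrow> real" where
  "utility f v b i = (v $ i - b $ i) * allocation f b i"

definition change_bid :: "real ^ 'n \<Rightarrow> 'n::finite \<Rightarrow> real \<Rightarrow> real ^ 'n" where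
  "change_bid b i x = (\<chi> j. if j = i then x else b $ j)"

definition is_best_response ::
    "(real \<Rightarrow> real) \<Rightarrow> real ^ 'n \<Rightarrow> real ^ 'n \<Rightarrow> 'n::finite \<Rightarrow> real \<Rightarrow> bool" where
  "is_best_response f v b i x \<longleftrightarrow>
     0 \<le> x \<and>
     (\<forall>y\<ge>0. utility f v (change_bid b i y) i \<le> utility f v (change_bid b i x) i)"

text \<open>The definite description denotes the maximiser only where it exists and is unique.
  For the weight function \<open>exp (c * x) - 1\<close> with \<open>c > 0\<close> and positive values, this is the
  case whenever at least two bids are positive (so that some competitor of each bidder
  bids a positive amount); elsewhere the value is unspecified.\<close>

definition best_response ::
    "(real \<Rightarrow> real) \<Rightarrow> real ^ 'n \<Rightarrow> real ^ 'n \<Rightarrow> 'n::finite \<Rightarrow> real" where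
  "best_response f v b i = (THE x. is_best_response f v b i x)"

definition BR :: "(real \<Rightarrow> real) \<Rightarrow> real ^ 'n \<Rightarrow> real ^ 'n \<Rightarrow> real ^ 'n::finite" where
  "BR f v b = (\<chi> i. best_response f v b i)"

definition exp_weight :: "real \<Rightarrow> real \<Rightarrow> real" where
  "exp_weight c x = exp (c * x) - 1"

end

theory Submission
  imports Defs
begin

text \<open>Write \<open>S\<close> for the total weight of the rivals of bidder \<open>i\<close>. The derivative of the utility in
  the own bid \<open>x\<close> has the sign of \<open>v\<^sub>i - foc c S x\<close>, where \<open>foc c S\<close> is strictly increasing, so
  a solution of \<open>foc c S x = v\<^sub>i\<close> is the best response. The hypothesis on \<open>w\<close> says
  \<open>foc c S w\<^sub>i \<le> v\<^sub>i\<close>. Since \<open>foc c S x\<close> decreases in \<open>S\<close>, the bid vectors above \<open>w\<close> that satisfy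
  all these inequalities have a componentwise supremum that satisfies them too, as in the
  Knaster--Tarski theorem. There each inequality is tight, because otherwise that bid could be raised
  on its own.\<close>

text \<open>For own allocation a = \<open>exp_weight c x / (exp_weight c x + S)\<close> the last
  factor is 1/(1 - a). Writing it through \<open>S\<close> isolates the influence of the rivals in
  one number.\<close>

definition foc :: "real \<Rightarrow> real \<Rightarrow> real \<Rightarrow> real" where
  "foc c S x = x + (1 - exp (- (c * x))) / c * (1 + exp_weight c x / S)"

definition rival_weight :: "real \<Rightarrow> real ^ 'n \<Rightarrow> 'n::finite \<Rightarrow> real" where
  "rival_weight c b i = (\<Sum>j\<in>UNIV - {i}. exp_weight c (b $ j))"

lemma exp_weight_nonneg: "c > 0 \<Longrightarrow> x \<ge> 0 \<Longrightarrow> exp_weight c x \<ge> 0"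
  by (simp add: exp_weight_def)

lemma exp_weight_pos: "c > 0 \<Longrightarrow> x > 0 \<Longrightarrow> exp_weight c x > 0"
  by (simp add: exp_weight_def)

lemma exp_weight_mono: "c > 0 \<Longrightarrow> x \<le> y \<Longrightarrow> exp_weight c x \<le> exp_weight c y"
  by (simp add: exp_weight_def)

lemma continuous_on_foc: "S \<noteq> 0 \<Longrightarrow> continuous_on A (foc c S)"
  unfolding foc_def exp_weight_def divide_inverse by (intro continuous_intros)

lemma foc_ge:
  assumes "c > 0" "S > 0" "x \<ge> 0"
  shows "x \<le> foc c S x"
  using assms exp_weight_nonneg[of c x] by (simp add: foc_def)

text \<open>Strictness comes from the summand \<open>x\<close> alone; monotonicity of the product is
  enough for the rest.\<close>

lemma foc_strict_mono:
  assumes "c > 0" "S > 0" "0 \<le> x" "x < y"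
  shows "foc c S x < foc c S y"
proof -
  have "(1 - exp (- (c * x))) / c * (1 + exp_weight c x / S)
      \<le> (1 - exp (- (c * y))) / c * (1 + exp_weight c y / S)"
    using assms exp_weight_nonneg[of c x] exp_weight_mono[of c x y]
    by (intro mult_mono divide_right_mono add_left_mono) auto
  then show ?thesis
    using assms by (simp add: foc_def)
qed

text \<open>Strategic complementarity: heavier rival bidding weakens the pull to shade one's own
  bid.\<close>

lemma foc_antimono_weight:
  assumes "c > 0" "0 < S" "S \<le> T" "x \<ge> 0"
  shows "foc c T x \<le> foc c S x"
proof -
  have "exp_weight c x / T \<le> exp_weight c x / S"
    using assms exp_weight_nonneg[of c x] by (intro divide_left_mono) auto
  then show ?thesis
    unfolding foc_def using assms by (intro add_left_mono mult_left_mono) auto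
qed

lemma sum_exp_weight_split:
  "(\<Sum>j\<in>UNIV. exp_weight c (b $ j)) = exp_weight c (b $ i) + rival_weight c b i"
  unfolding rival_weight_def by (rule sum.remove) auto

lemma rival_weight_change_bid_self: "rival_weight c (change_bid b i x) i = rival_weight c b i"
  unfolding rival_weight_def by (intro sum.cong) (auto simp: change_bid_def)

lemma rival_weight_mono:
  assumes "c > 0" "\<And>j. b $ j \<le> b' $ j"
  shows "rival_weight c b i \<le> rival_weight c b' i"
  unfolding rival_weight_def using assms by (intro sum_mono exp_weight_mono)

text \<open>Of two positive bidders, at least one is a rival of \<open>i\<close>.\<close>

lemma rival_weight_pos:
  assumes "c > 0" "\<And>j. b $ j \<ge> 0" "card {j. b $ j > 0} \<ge> 2"
  shows "rival_weight c b i > 0"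
proof -
  have "\<not> {j. b $ j > 0} \<subseteq> {i}"
    using assms(3) card_mono[of "{i}" "{j. b $ j > 0}"] by auto
  then obtain j where "j \<noteq> i" "b $ j > 0" by auto
  then show ?thesis
    unfolding rival_weight_def using assms
    by (intro sum_pos2[of _ j]) (auto intro: exp_weight_pos exp_weight_nonneg)
qed

lemma utility_change_bid:
  "utility (exp_weight c) v (change_bid b i x) i =
    (v $ i - x) * exp_weight c x / (exp_weight c x + rival_weight c b i)"
  using sum_exp_weight_split[of c "change_bid b i x" i]
  by (simp add: utility_def allocation_def rival_weight_change_bid_self)
     (simp add: change_bid_def)

text \<open>The quotient rule, factored so that the sign of the derivative is that of
  \<open>V - foc c S x\<close>.\<close>

lemma payoff_has_derivative:
  assumes "c > 0" "S > 0" "x \<ge> 0"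
  shows "((\<lambda>x. (V - x) * exp_weight c x / (exp_weight c x + S)) has_real_derivative
    c * exp (c * x) * S / (exp_weight c x + S)\<^sup>2 * (V - foc c S x)) (at x)"
proof -
  \<comment> \<open>With the exponential named, the factorization is an identity of rational
    functions in \<open>E\<close>.\<close>
  define E where "E = exp (c * x)"
  have E0: "E \<noteq> 0" and pos: "E - 1 + S > 0"
    using assms by (auto simp: E_def intro: add_nonneg_pos)
  have "c * E * S * (V - (x + (1 - 1 / E) / c * (1 + (E - 1) / S)))
      = ((V - x) * (c * E) - (E - 1)) * (E - 1 + S) - (V - x) * (E - 1) * (c * E)"
    using assms E0 by (simp add: field_simps)
  then have foc: "c * E * S / (E - 1 + S)\<^sup>2 * (V - foc c S x)
      = (((V - x) * (c * E) - (E - 1)) * (E - 1 + S) - (V - x) * (E - 1) * (c * E))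
          / ((E - 1 + S) * (E - 1 + S))"
    by (simp add: foc_def exp_weight_def E_def exp_minus inverse_eq_divide power2_eq_square)
  have "((\<lambda>x. (V - x) * exp_weight c x / (exp_weight c x + S)) has_real_derivative
      (((V - x) * (c * E) - (E - 1)) * (E - 1 + S) - (V - x) * (E - 1) * (c * E))
          / ((E - 1 + S) * (E - 1 + S))) (at x)"
    unfolding exp_weight_def E_def using pos
    by (auto intro!: derivative_eq_intros simp: E_def algebra_simps)
  then show ?thesis
    using foc by (simp add: exp_weight_def E_def)
qed

text \<open>As \<open>foc c S\<close> crosses \<open>V\<close> at \<open>x\<close>, the payoff
  strictly rises before \<open>x\<close> and strictly falls after it. Strictness is what later
  yields uniqueness of the maximizer.\<close>

lemma payoff_less_critical:
  assumes "c > 0" "S > 0" "x \<ge> 0" "y \<ge> 0" "y \<noteq> x" "foc c S x = V"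
  shows "(V - y) * exp_weight c y / (exp_weight c y + S)
    < (V - x) * exp_weight c x / (exp_weight c x + S)"
proof -
  let ?u = "\<lambda>z. (V - z) * exp_weight c z / (exp_weight c z + S)"
  let ?d = "\<lambda>z. c * exp (c * z) * S / (exp_weight c z + S)\<^sup>2"
  have deriv: "(?u has_real_derivative ?d z * (V - foc c S z)) (at z)" if "z \<ge> 0" for z
    using payoff_has_derivative assms that by blast
  have dpos: "?d z > 0" if "z \<ge> 0" for z
    using assms that exp_weight_nonneg[of c z] by auto
  have cont: "continuous_on {p..q} ?u" if "p \<ge> 0" for p q
    using that by (intro continuous_at_imp_continuous_on ballI DERIV_isCont[OF deriv]) auto
  show ?thesis
  proof (cases "y < x")
    case True
    then show ?thesis
    \<comment> \<open>The derivative vanishes at \<open>x\<close>, so its sign may only be required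
      on the open interval.\<close>
    proof (rule DERIV_pos_imp_increasing_open)
      fix z assume z: "y < z" "z < x"
      with assms have "?d z * (V - foc c S z) > 0"
        using foc_strict_mono[of c S z x] dpos[of z] by (intro mult_pos_pos) auto
      with deriv[of z] z assms show "\<exists>d. (?u has_real_derivative d) (at z) \<and> d > 0" by auto
    qed (use cont assms in auto)
  next
    case False
    with assms have "x < y" by simp
    then show ?thesis
    proof (rule DERIV_neg_imp_decreasing_open)
      fix z assume z: "x < z" "z < y"
      with assms have "?d z * (V - foc c S z) < 0"
        using foc_strict_mono[of c S x z] dpos[of z] by (intro mult_pos_neg) auto
      with deriv[of z] z assms show "\<exists>d. (?u has_real_derivative d) (at z) \<and> d < 0" by auto
    qed (use cont assms in auto)
  qed
qed

lemma best_response_eqI: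
  assumes "c > 0" "rival_weight c b i > 0" "x \<ge> 0" "foc c (rival_weight c b i) x = v $ i"
  shows "best_response (exp_weight c) v b i = x"
proof -
  have less: "utility (exp_weight c) v (change_bid b i y) i
      < utility (exp_weight c) v (change_bid b i x) i" if "y \<ge> 0" "y \<noteq> x" for y
    using payoff_less_critical[OF assms(1-3) that assms(4)] by (simp add: utility_change_bid)
  show ?thesis
    unfolding best_response_def
  proof (rule the_equality)
    show "is_best_response (exp_weight c) v b i x"
      using less assms by (force simp: is_best_response_def)
    show "y = x" if "is_best_response (exp_weight c) v b i y" for y
      using that less[of y] assms by (force simp: is_best_response_def)
  qed
qed

text \<open>Here 1 - a is the rivals' share of the total weight. This turns the hypothesis on
  \<open>w\<close> into an inequality for \<open>foc\<close>.\<close>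

lemma allocation_condition_eq_foc:
  assumes "c > 0" "rival_weight c b i > 0" "b $ i \<ge> 0"
  shows "b $ i + 1 / c * (1 - 1 / exp (c * b $ i)) * (1 / (1 - allocation (exp_weight c) b i))
    = foc c (rival_weight c b i) (b $ i)"
proof -
  have "1 / (1 - allocation (exp_weight c) b i) = 1 + exp_weight c (b $ i) / rival_weight c b i"
    using assms exp_weight_nonneg[of c "b $ i"]
    by (simp add: allocation_def sum_exp_weight_split[of c b i] field_simps)
  then show ?thesis
    by (simp add: foc_def exp_minus inverse_eq_divide)
qed

lemma exists_foc_solution:
  fixes v w :: "real ^ 'n::finite"
  assumes c: "c > 0" and w: "\<And>i. w $ i \<ge> 0" and S: "\<And>i. rival_weight c w i > 0"
    and sub: "\<And>i. foc c (rival_weight c w i) (w $ i) \<le> v $ i"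
  shows "\<exists>b. \<forall>i. w $ i \<le> b $ i \<and> foc c (rival_weight c b i) (b $ i) = v $ i"
proof -
  define P where "P = {b. \<forall>i. w $ i \<le> b $ i \<and> foc c (rival_weight c b i) (b $ i) \<le> v $ i}"
  define s :: "real ^ 'n" where "s = (\<chi> i. SUP b\<in>P. b $ i)"
  have wP: "w \<in> P" using sub by (auto simp: P_def)
  \<comment> \<open>Positivity is inherited from \<open>w\<close>, so every \<open>foc\<close> below
    has a positive weight parameter.\<close>
  have pos: "rival_weight c b i > 0" if "\<And>j. w $ j \<le> b $ j" for b i
    using S[of i] rival_weight_mono[OF c that, of i] by linarith
  have le_v: "b $ i \<le> v $ i" if "b \<in> P" for b i
  proof -
    have "b $ i \<ge> 0" using that w[of i] by (auto simp: P_def intro: order_trans)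
    then have "b $ i \<le> foc c (rival_weight c b i) (b $ i)"
      using that by (intro foc_ge c pos) (auto simp: P_def)
    also have "\<dots> \<le> v $ i" using that by (auto simp: P_def)
    finally show ?thesis .
  qed
  have bdd: "bdd_above ((\<lambda>b. b $ i) ` P)" for i
    using le_v by (auto simp: bdd_above_def)
  have le_s: "b $ i \<le> s $ i" if "b \<in> P" for b i
    using cSUP_upper[OF that bdd] by (simp add: s_def)
  have ws: "w $ i \<le> s $ i" for i by (rule le_s[OF wP])
  have s0: "s $ i \<ge> 0" for i using w[of i] ws[of i] by linarith
  have spos: "rival_weight c s i > 0" for i by (rule pos) (rule ws)
  have foc_s: "foc c (rival_weight c s i) (s $ i) \<le> v $ i" for i
  proof -
    \<comment> \<open>With the rivals fixed at \<open>s\<close>, the condition on bid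
      \<open>i\<close> is closed. Each \<open>b\<close> in \<open>P\<close> meets it, since moving
      the rivals up from \<open>b\<close> to \<open>s\<close> only lowers \<open>foc\<close>; hence
      so does the supremum.\<close>
    have "s $ i \<in> {x. foc c (rival_weight c s i) x \<le> v $ i}"
      unfolding s_def vec_lambda_beta
    proof (rule closed_subset_contains_Sup)
      show "closed {x. foc c (rival_weight c (\<chi> i. SUP b\<in>P. b $ i) i) x \<le> v $ i}"
        using spos[of i] unfolding s_def
        by (intro closed_Collect_le continuous_on_foc continuous_on_const) auto
      show "(\<lambda>b. b $ i) ` P \<subseteq> {x. foc c (rival_weight c (\<chi> i. SUP b\<in>P. b $ i) i) x \<le> v $ i}"
      proof clarify
        fix b assume b: "b \<in> P"
        have "b $ i \<ge> 0" using b w[of i] by (auto simp: P_def intro: order_trans)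
        then have "foc c (rival_weight c s i) (b $ i) \<le> foc c (rival_weight c b i) (b $ i)"
          using b by (intro foc_antimono_weight rival_weight_mono c pos le_s) (auto simp: P_def)
        also have "\<dots> \<le> v $ i" using b by (auto simp: P_def)
        finally show "foc c (rival_weight c (\<chi> i. SUP b\<in>P. b $ i) i) (b $ i) \<le> v $ i"
          by (simp add: s_def)
      qed
    qed (use wP bdd in auto)
    then show ?thesis by simp
  qed
  have "foc c (rival_weight c s i) (s $ i) = v $ i" for i
  proof -
    have sv: "s $ i \<le> v $ i"
      using foc_ge[OF c spos s0, of i i] foc_s[of i] by linarith
    \<comment> \<open>As \<open>foc\<close> dominates the identity, \<open>v $ i\<close> can serve
      as the upper endpoint for the intermediate value theorem.\<close>
    then have "v $ i \<le> foc c (rival_weight c s i) (v $ i)"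
      using s0[of i] by (intro foc_ge c spos) auto
    moreover have "continuous_on {s $ i..v $ i} (foc c (rival_weight c s i))"
      using spos[of i] by (intro continuous_on_foc) auto
    ultimately obtain x where x: "s $ i \<le> x" "foc c (rival_weight c s i) x = v $ i"
      using IVT'[of "foc c (rival_weight c s i)" "s $ i" "v $ i" "v $ i"] foc_s[of i] sv by auto
    \<comment> \<open>Raising only bid \<open>i\<close> to \<open>x\<close> stays inside
      \<open>P\<close>: bidder \<open>i\<close> becomes tight and the others gain slack. Since
      \<open>s\<close> bounds \<open>P\<close>, this forces \<open>x = s $ i\<close>.\<close>
    define t where "t = change_bid s i x"
    have st: "s $ j \<le> t $ j" for j using x by (simp add: t_def change_bid_def)
    have "foc c (rival_weight c t j) (t $ j) \<le> v $ j" for j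
    proof (cases "j = i")
      case True
      then show ?thesis using x
        by (simp add: t_def rival_weight_change_bid_self) (simp add: change_bid_def)
    next
      case False
      then have tj: "t $ j = s $ j" by (simp add: t_def change_bid_def)
      have "foc c (rival_weight c t j) (s $ j) \<le> foc c (rival_weight c s j) (s $ j)"
        by (intro foc_antimono_weight rival_weight_mono c spos s0 st)
      with foc_s[of j] tj show ?thesis by simp
    qed
    moreover have "w $ j \<le> t $ j" for j
      using ws st by (rule order_trans)
    ultimately have "t \<in> P" by (simp add: P_def)
    then have "x \<le> s $ i" using le_s[of t i] by (simp add: t_def change_bid_def)
    with x show ?thesis by simp
  qed
  with ws show ?thesis by blast
qed

theorem theorem2p4:
  fixes c :: real and v w :: "real ^ 'n::finite"
  assumes "CARD('n) \<ge> 2"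
    and "c > 0"
    and "\<And>i. v $ i > 0"
    and "\<And>i. w $ i \<ge> 0"
    and "card {i. w $ i > 0} \<ge> 2"
    and "\<And>i. w $ i \<le> v $ i - 1 / c * (1 - 1 / exp (c * w $ i))
                        * (1 / (1 - allocation (exp_weight c) w i))"
  shows "\<exists>b. (\<forall>i. b $ i \<in> {w $ i..v $ i}) \<and> BR (exp_weight c) v b = b"
proof -
  have S: "rival_weight c w i > 0" for i
    using assms(2,4,5) by (rule rival_weight_pos)
  have "foc c (rival_weight c w i) (w $ i) \<le> v $ i" for i
    using assms(6)[of i] allocation_condition_eq_foc[OF assms(2) S assms(4), of i] by simp
  from exists_foc_solution[OF assms(2,4) S this] obtain b where
    b: "\<And>i. w $ i \<le> b $ i" "\<And>i. foc c (rival_weight c b i) (b $ i) = v $ i"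
    by blast
  have b0: "b $ i \<ge> 0" for i
    using assms(4) b(1) by (rule order_trans)
  have bpos: "rival_weight c b i > 0" for i
    using S[of i] rival_weight_mono[OF assms(2) b(1), of i] by linarith
  \<comment> \<open>The upper bound follows from the first-order equation itself, because a bid
    never exceeds its \<open>foc\<close>.\<close>
  have "b $ i \<le> v $ i" for i
    using foc_ge[OF assms(2) bpos b0, of i i] b(2) by simp
  moreover have "BR (exp_weight c) v b = b"
    using best_response_eqI[OF assms(2) bpos b0 b(2)] by (simp add: BR_def vec_eq_iff)
  ultimately show ?thesis using b(1) by auto
qed

end
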